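(* Let $\{S_i\}_{i=1}^m$ be an SS-IFS in $\mathbb{R}^d$ with attractor $K\subseteq\mathbb{R}^d$ containing at least two points, let $s$ be its similarity dimension, and let $L:\mathbb{R}^d\to\mathbb{R}^{d_2}$ be a linear map. Assume that the transformation group $\mathcal{T}=\{O_1,\ldots,O_q\}$ of the SS-IFS is a finite group, where $q=|\mathcal{T}|$. Then there exists a strongly connected GD-IFS $\{S_e:e\in\mathcal{E}\}$ in $\mathbb{R}^{d_2}$ with attractor $\left(L\circ O_1(K),\ldots,L\circ O_q(K)\right)$ such that the similarity dimension of this GD-IFS is $s$ and the orthogonal part $T_e$ of $S_e$ is the identity map for every directed edge $e\in\mathcal{E}$. Additionally, $\mathcal{H}^s(L\circ O_1(K))=\ldots=\mathcal{H}^s(L\circ O_q(K))$.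
   Context: $\mathcal{H}^s$ denotes $s$-dimensional Hausdorff measure. A self-similar iterated function system (SS-IFS) in $\mathbb{R}^d$ is a finite collection $\{S_i\}_{i=1}^m$ of contracting similarities of $\mathbb{R}^d$, written uniquely as $S_i(x)=r_iT_i(x)+v_i$ with $0<r_i<1$, $T_i$ an orthogonal transformation of $\mathbb{R}^d$ and $v_i\in\mathbb{R}^d$. Its attractor is the unique nonempty compact $K$ with $K=\bigcup_{i=1}^m S_i(K)$. Its similarity dimension is the unique $s$ with $\sum_{i=1}^m r_i^s=1$. Its transformation group $\mathcal{T}$ is the group generated by $T_1,\ldots,T_m$. Let $G(\mathcal{V},\mathcal{E})$ be a directed graph (multiple edges and loops allowed) with vertex set $\mathcal{V}=\{1,\ldots,q\}$ and finite edge set $\mathcal{E}$ such that every vertex has at least one edge starting from it; $\mathcal{E}_{i,j}$ is the set of edges from $i$ to $j$. A graph directed iterated function system (GD-IFS) in $\mathbb{R}^{n}$ on this graph is a finite collection $\{S_e:e\in\mathcal{E}\}$ of contracting similarities of $\mathbb{R}^{n}$, written uniquely as $S_e(x)=r_eT_e(x)+v_e$ with $0<r_e<1$, $T_e$ orthogonal, $v_e\in\mathbb{R}^{n}$. Its attractor is the unique $q$-tuple $(K_1,\ldots,K_q)$ of nonempty compact sets with $K_i=\bigcup_{j=1}^q\bigcup_{e\in\mathcal{E}_{i,j}}S_e(K_j)$ for all $i$. Its similarity dimension is the unique $s$ such that the $q\times q$ matrix $A^{(s)}$ with entries $A^{(s)}_{i,j}=\sum_{e\in\mathcal{E}_{i,j}}r_e^s$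 has spectral radius $1$. The GD-IFS is strongly connected if for every pair of vertices $i,j$ there is a directed path from $i$ to $j$ and a directed path from $j$ to $i$. *)

theory Defs
  imports
    "HOL-Analysis.Analysis"
    "HOL-Algebra.Bij"
    "HOL-Algebra.Generated_Groups"
    "Graph_Theory.Digraph_Component"
    "Jordan_Normal_Form.Spectral_Radius"
begin

section \<open>Hausdorff measure\<close>

text \<open>The term \<open>diam(U)\<^sup>s\<close>. The cases are separated because \<open>0 powr 0 = 0\<close> in HOL, whereas for
  \<open>s = 0\<close> every nonempty set has to count as \<open>1\<close> (counting measure).\<close>

definition diam_pow :: "real \<Rightarrow> 'a::metric_space set \<Rightarrow> ennreal" where
  "diam_pow s U =
     (if U = {} then 0 else if s = 0 then 1 else ennreal (diameter U powr s))"

text \<open>Covers are required to be bounded because \<^const>\<open>diameter\<close> is unspecified on unbounded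
  sets. Finite covers are included by padding with the empty set.\<close>

definition hausdorff_delta :: "real \<Rightarrow> real \<Rightarrow> 'a::metric_space set \<Rightarrow> ennreal" where
  "hausdorff_delta s \<delta> E =
     (INF U \<in> {U :: nat \<Rightarrow> 'a set. E \<subseteq> (\<Union>n. U n) \<and> (\<forall>n. bounded (U n) \<and> diameter (U n) \<le> \<delta>)}.
        \<Sum>n. diam_pow s (U n))"

definition hausdorff_measure :: "real \<Rightarrow> 'a::metric_space set \<Rightarrow> ennreal" where
  "hausdorff_measure s E = (SUP \<delta> \<in> {0<..}. hausdorff_delta s \<delta> E)"


section \<open>Self-similar iterated function systems\<close>

text \<open>\<open>S\<close> is the contracting similarity whose (unique) decomposition has ratio \<open>r\<close>, orthogonal
  part \<open>T\<close> and translation vector \<open>v\<close>.\<close>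

definition contracting_similarity ::
    "('a::euclidean_space \<Rightarrow> 'a) \<Rightarrow> real \<Rightarrow> ('a \<Rightarrow> 'a) \<Rightarrow> 'a \<Rightarrow> bool" where
  "contracting_similarity S r T v \<longleftrightarrow>
     0 < r \<and> r < 1 \<and> orthogonal_transformation T \<and> (\<forall>x. S x = r *\<^sub>R T x + v)"

definition ss_ifs ::
    "nat \<Rightarrow> (nat \<Rightarrow> 'a::euclidean_space \<Rightarrow> 'a) \<Rightarrow> (nat \<Rightarrow> real) \<Rightarrow> (nat \<Rightarrow> 'a \<Rightarrow> 'a) \<Rightarrow> (nat \<Rightarrow> 'a) \<Rightarrow> bool"
where
  "ss_ifs m S r T v \<longleftrightarrow>
     1 \<le> m \<and> (\<forall>i\<in>{1..m}. contracting_similarity (S i) (r i) (T i) (v i))"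

text \<open>Existence and uniqueness of such a \<open>K\<close> (and of the tuple in \<open>gd_attractor\<close> below) are
  Hutchinson's theorem; likewise \<open>ss_similarity_dimension\<close> and \<open>gd_similarity_dimension\<close> determine
  \<open>s\<close>.\<close>

definition ss_attractor :: "nat \<Rightarrow> (nat \<Rightarrow> 'a::euclidean_space \<Rightarrow> 'a) \<Rightarrow> 'a set \<Rightarrow> bool" where
  "ss_attractor m S K \<longleftrightarrow> compact K \<and> K \<noteq> {} \<and> K = (\<Union>i\<in>{1..m}. S i ` K)"

definition ss_similarity_dimension :: "nat \<Rightarrow> (nat \<Rightarrow> real) \<Rightarrow> real \<Rightarrow> bool" where
  "ss_similarity_dimension m r s \<longleftrightarrow> (\<Sum>i = 1..m. r i powr s) = 1"

text \<open>The underlying set of the subgroup generated by \<open>T 1, ..., T m\<close> in the group of all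
  bijections of the space under composition.\<close>

definition transformation_group :: "nat \<Rightarrow> (nat \<Rightarrow> 'a::euclidean_space \<Rightarrow> 'a) \<Rightarrow> ('a \<Rightarrow> 'a) set" where
  "transformation_group m T = generate (BijGroup UNIV) (T ` {1..m})"


section \<open>Graph directed iterated function systems\<close>

definition edges_between :: "('v, 'e) pre_digraph \<Rightarrow> 'v \<Rightarrow> 'v \<Rightarrow> 'e set" where
  "edges_between G i j = {e \<in> arcs G. tail G e = i \<and> head G e = j}"

definition gd_ifs ::
    "nat \<Rightarrow> (nat, 'e) pre_digraph \<Rightarrow> ('e \<Rightarrow> 'a::euclidean_space \<Rightarrow> 'a) \<Rightarrow> ('e \<Rightarrow> real) \<Rightarrow>
     ('e \<Rightarrow> 'a \<Rightarrow> 'a) \<Rightarrow> ('e \<Rightarrow> 'a) \<Rightarrow> bool"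
where
  "gd_ifs q G S r T v \<longleftrightarrow>
     fin_digraph G \<and> verts G = {1..q} \<and>
     (\<forall>i\<in>verts G. \<exists>e\<in>arcs G. tail G e = i) \<and>
     (\<forall>e\<in>arcs G. contracting_similarity (S e) (r e) (T e) (v e))"

definition gd_attractor ::
    "nat \<Rightarrow> (nat, 'e) pre_digraph \<Rightarrow> ('e \<Rightarrow> 'a::euclidean_space \<Rightarrow> 'a) \<Rightarrow> (nat \<Rightarrow> 'a set) \<Rightarrow> bool"
where
  "gd_attractor q G S K \<longleftrightarrow>
     (\<forall>i\<in>{1..q}. compact (K i) \<and> K i \<noteq> {} \<and>
        K i = (\<Union>j\<in>{1..q}. \<Union>e\<in>edges_between G i j. S e ` K j))"

text \<open>Matrix indices start at \<open>0\<close>, the vertices at \<open>1\<close>, hence the shift. The entries are complex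
  because \<^const>\<open>spectral_radius\<close> takes complex eigenvalues into account.\<close>

definition gd_matrix :: "nat \<Rightarrow> (nat, 'e) pre_digraph \<Rightarrow> ('e \<Rightarrow> real) \<Rightarrow> real \<Rightarrow> complex mat" where
  "gd_matrix q G r s =
     mat q q (\<lambda>(i, j). complex_of_real (\<Sum>e\<in>edges_between G (Suc i) (Suc j). r e powr s))"

definition gd_similarity_dimension ::
    "nat \<Rightarrow> (nat, 'e) pre_digraph \<Rightarrow> ('e \<Rightarrow> real) \<Rightarrow> real \<Rightarrow> bool"
where
  "gd_similarity_dimension q G r s \<longleftrightarrow> spectral_radius (gd_matrix q G r s) = 1"

end

theory Submission
  imports Defs
begin

text \<open>
  Applying \<open>L \<circ> g\<close> to \<open>K = (\<Union>k. r k *\<^sub>R T k ` K + v k)\<close> expresses \<open>L (g ` K)\<close> through homothetic copies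
  of the sets \<open>L ((g \<circ> T k) ` K)\<close>. The graph is therefore the Cayley graph of the transformation group
  with respect to the \<open>T k\<close>; it is strongly connected because in a finite group the inverses of the
  generators are products of generators. Each row of the matrix sums to \<open>\<Sum>k. r k powr s = 1\<close>, so its
  spectral radius is 1. Finally \<open>h g = H\<^sup>s(L (g ` K))\<close> satisfies
  \<open>h g \<le> \<Sum>k. r k powr s * h (g \<circ> T k)\<close>, and the maximum principle on the strongly connected graph makes
  \<open>h\<close> constant, unless \<open>h\<close> takes the value infinity somewhere; then \<open>h g \<ge> r k powr s * h (g \<circ> T k)\<close>
  spreads that value to all vertices.
\<close>

section \<open>Hausdorff measure\<close>

text \<open>Approximate each infimum to within \<open>e/2\<close> separately.
  \<open>ennreal_le_epsilon\<close> leaves only the case of a finite right-hand side, where such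
  approximants exist. This lets two covers be chosen independently.\<close>

lemma le_INF_add_INF_ennreal:
  fixes f :: "'a \<Rightarrow> ennreal" and g :: "'b \<Rightarrow> ennreal"
  assumes le: "\<And>x y. x \<in> I \<Longrightarrow> y \<in> J \<Longrightarrow> a \<le> f x + g y"
  shows "a \<le> (INF x\<in>I. f x) + (INF y\<in>J. g y)"
proof (rule ennreal_le_epsilon)
  fix e :: real
  assume fin: "(INF x\<in>I. f x) + (INF y\<in>J. g y) < Orderings.top" and e: "0 < e"
  have fin': "(INF x\<in>I. f x) \<noteq> \<infinity>" "(INF y\<in>J. g y) \<noteq> \<infinity>"
    using fin by (auto simp flip: less_top)
  obtain x where x: "x \<in> I" "f x < (INF x\<in>I. f x) + ennreal (e/2)"
    using INF_approx_ennreal[OF half_gt_zero[OF e] refl fin'(1)] by blast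
  obtain y where y: "y \<in> J" "g y < (INF y\<in>J. g y) + ennreal (e/2)"
    using INF_approx_ennreal[OF half_gt_zero[OF e] refl fin'(2)] by blast
  have "a \<le> f x + g y"
    using le x y by blast
  also have "\<dots> \<le> ((INF x\<in>I. f x) + ennreal (e/2)) + ((INF y\<in>J. g y) + ennreal (e/2))"
    using x y by (intro add_mono) auto
  also have "\<dots> = ((INF x\<in>I. f x) + (INF y\<in>J. g y)) + (ennreal (e/2) + ennreal (e/2))"
    by (simp add: ac_simps)
  also have "ennreal (e/2) + ennreal (e/2) = ennreal e"
    using e by (simp flip: ennreal_plus)
  finally show "a \<le> (INF x\<in>I. f x) + (INF y\<in>J. g y) + ennreal e" .
qed

text \<open>Partial sums of even length split exactly into one partial sum of each series; as terms
  are nonnegative, any partial sum is dominated by the one of twice its length.\<close>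

lemma suminf_interleave_le_ennreal:
  fixes f g :: "nat \<Rightarrow> ennreal"
  shows "(\<Sum>n. if even n then f (n div 2) else g (n div 2)) \<le> suminf f + suminf g"
proof (rule suminf_le_const)
  let ?h = "\<lambda>n. if even n then f (n div 2) else g (n div 2)"
  have double: "sum ?h {..<2 * n} = sum f {..<n} + sum g {..<n}" for n
    by (induction n) (auto simp: ac_simps)
  fix n
  have "sum ?h {..<n} \<le> sum ?h {..<2 * n}"
    by (intro sum_mono2) auto
  also have "\<dots> \<le> suminf f + suminf g"
    unfolding double by (intro add_mono sum_le_suminf) auto
  finally show "sum ?h {..<n} \<le> suminf f + suminf g" .
qed auto

lemma hausdorff_delta_Un_le:
  "hausdorff_delta s \<delta> (A \<union> B) \<le> hausdorff_delta s \<delta> A + hausdorff_delta s \<delta> B"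
  unfolding hausdorff_delta_def[of s \<delta> A] hausdorff_delta_def[of s \<delta> B]
proof (rule le_INF_add_INF_ennreal, clarify)
  fix U V :: "nat \<Rightarrow> 'a set"
  assume U: "A \<subseteq> (\<Union>n. U n)" "\<forall>n. bounded (U n) \<and> diameter (U n) \<le> \<delta>"
    and V: "B \<subseteq> (\<Union>n. V n)" "\<forall>n. bounded (V n) \<and> diameter (V n) \<le> \<delta>"
  \<comment> \<open>Even indices run through the cover of \<open>A\<close>, odd ones through that of
    \<open>B\<close>; the pieces are unchanged, so the same \<delta> bounds them.\<close>
  define W where "W n = (if even n then U (n div 2) else V (n div 2))" for n
  have "A \<union> B \<subseteq> (\<Union>n. W n)"
  proof
    fix z assume "z \<in> A \<union> B"
    then obtain n where "z \<in> W (2 * n) \<or> z \<in> W (2 * n + 1)"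
      using U(1) V(1) by (fastforce simp: W_def)
    then show "z \<in> (\<Union>n. W n)" by blast
  qed
  moreover have "\<forall>n. bounded (W n) \<and> diameter (W n) \<le> \<delta>"
    using U(2) V(2) by (auto simp: W_def)
  ultimately have "hausdorff_delta s \<delta> (A \<union> B) \<le> (\<Sum>n. diam_pow s (W n))"
    unfolding hausdorff_delta_def by (intro INF_lower) auto
  also have "(\<lambda>n. diam_pow s (W n))
      = (\<lambda>n. if even n then diam_pow s (U (n div 2)) else diam_pow s (V (n div 2)))"
    by (auto simp: W_def)
  also have "suminf \<dots> \<le> (\<Sum>n. diam_pow s (U n)) + (\<Sum>n. diam_pow s (V n))"
    by (rule suminf_interleave_le_ennreal)
  finally show "hausdorff_delta s \<delta> (A \<union> B)
      \<le> (\<Sum>n. diam_pow s (U n)) + (\<Sum>n. diam_pow s (V n))" .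
qed

lemma hausdorff_delta_mono: "A \<subseteq> B \<Longrightarrow> hausdorff_delta s \<delta> A \<le> hausdorff_delta s \<delta> B"
  unfolding hausdorff_delta_def by (intro INF_superset_mono) auto

lemma hausdorff_measure_mono: "A \<subseteq> B \<Longrightarrow> hausdorff_measure s A \<le> hausdorff_measure s B"
  unfolding hausdorff_measure_def by (intro SUP_mono') (rule hausdorff_delta_mono)

lemma hausdorff_measure_Un_le:
  "hausdorff_measure s (A \<union> B) \<le> hausdorff_measure s A + hausdorff_measure s B"
  unfolding hausdorff_measure_def[of s "A \<union> B"]
proof (rule SUP_least)
  fix \<delta> :: real
  assume \<delta>: "\<delta> \<in> {0<..}"
  have "hausdorff_delta s \<delta> (A \<union> B) \<le> hausdorff_delta s \<delta> A + hausdorff_delta s \<delta> B"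
    by (rule hausdorff_delta_Un_le)
  also have "\<dots> \<le> hausdorff_measure s A + hausdorff_measure s B"
    unfolding hausdorff_measure_def using \<delta> by (intro add_mono SUP_upper)
  finally show "hausdorff_delta s \<delta> (A \<union> B) \<le> hausdorff_measure s A + hausdorff_measure s B" .
qed

lemma hausdorff_measure_empty [simp]: "hausdorff_measure s {} = 0"
proof -
  have "hausdorff_delta s \<delta> ({} :: 'a set) = 0" if "\<delta> > 0" for \<delta>
  proof -
    \<comment> \<open>The constantly empty cover has cost 0 for every \<open>s\<close>, since
      \<open>diam_pow\<close> treats the empty set before the case \<open>s = 0\<close>.\<close>
    have "hausdorff_delta s \<delta> ({} :: 'a set) \<le> (\<Sum>n. diam_pow s (({} :: 'a set)))"
      unfolding hausdorff_delta_def using that by (intro INF_lower) auto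
    then show ?thesis
      by (simp add: diam_pow_def)
  qed
  then show ?thesis
    by (simp add: hausdorff_measure_def)
qed

lemma hausdorff_measure_UN_le:
  "finite I \<Longrightarrow> hausdorff_measure s (\<Union>i\<in>I. A i) \<le> (\<Sum>i\<in>I. hausdorff_measure s (A i))"
proof (induction I rule: finite_induct)
  case (insert i I)
  have "hausdorff_measure s (\<Union>j\<in>insert i I. A j)
      \<le> hausdorff_measure s (A i) + hausdorff_measure s (\<Union>j\<in>I. A j)"
    using hausdorff_measure_Un_le by simp
  also have "\<dots> \<le> hausdorff_measure s (A i) + (\<Sum>i\<in>I. hausdorff_measure s (A i))"
    using insert.IH by (intro add_left_mono)
  finally show ?case
    using insert.hyps by simp
qed simp

section \<open>Scaling of diameters and of Hausdorff measure under similarities\<close>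

lemma diameter_similarity_image:
  fixes f :: "'a::metric_space \<Rightarrow> 'b::metric_space"
  assumes c: "0 < c" and f: "\<And>x y. dist (f x) (f y) = c * dist x y" and U: "bounded U"
  shows "bounded (f ` U)" "diameter (f ` U) = c * diameter U"
proof -
  have bound: "dist (f x) (f y) \<le> c * diameter U" if "x \<in> U" "y \<in> U" for x y
    using that U c f diameter_bounded_bound by (metis mult_left_mono less_imp_le)
  show bdd: "bounded (f ` U)"
    unfolding bounded_two_points using bound by blast
  show "diameter (f ` U) = c * diameter U"
  \<comment> \<open>The diameter of the empty set is 0 by convention; only otherwise is it a
    supremum that \<open>cSUP_least\<close> can bound.\<close>
  proof (cases "U = {}")
    case False
    have "diameter (f ` U) \<le> c * diameter U"
      unfolding diameter_def[of "f ` U"] using False bound by (auto intro!: cSUP_least)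
    moreover have "dist x y \<le> diameter (f ` U) / c" if "x \<in> U" "y \<in> U" for x y
      using diameter_bounded_bound[OF bdd, of "f x" "f y"] that c f
      by (simp add: field_simps)
    then have "diameter U \<le> diameter (f ` U) / c"
      unfolding diameter_def[of U] using False by (auto intro!: cSUP_least)
    ultimately show ?thesis
      using c by (simp add: field_simps)
  qed simp
qed

lemma diam_pow_similarity_image:
  assumes c: "0 < c" and f: "\<And>x y. dist (f x) (f y) = c * dist x y" and U: "bounded U"
  shows "diam_pow s (f ` U) = ennreal (c powr s) * diam_pow s U"
  using diameter_similarity_image[OF assms] c diameter_ge_0[OF U]
  by (simp add: diam_pow_def powr_mult flip: ennreal_mult)

lemma hausdorff_delta_similarity_image_le:
  fixes f :: "'a::metric_space \<Rightarrow> 'b::metric_space"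
  assumes c: "0 < c" and f: "\<And>x y. dist (f x) (f y) = c * dist x y"
  shows "hausdorff_delta s (c * \<delta>) (f ` E) \<le> ennreal (c powr s) * hausdorff_delta s \<delta> E"
proof -
  let ?X = "hausdorff_delta s (c * \<delta>) (f ` E)"
  \<comment> \<open>The positive finite factor is moved to the left, so that the bare infimum stands
    on the right and \<open>INF_greatest\<close> applies; afterwards it is moved back.\<close>
  have cancel: "ennreal (1 / c powr s) * (ennreal (c powr s) * x) = x"
    "ennreal (c powr s) * (ennreal (1 / c powr s) * x) = x" for x
    using c by (simp_all flip: mult.assoc ennreal_mult)
  have "ennreal (1 / c powr s) * ?X \<le> hausdorff_delta s \<delta> E"
    unfolding hausdorff_delta_def[of s \<delta> E]
  proof (rule INF_greatest, clarify)
    fix U :: "nat \<Rightarrow> 'a set"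
    assume U: "E \<subseteq> (\<Union>n. U n)" "\<forall>n. bounded (U n) \<and> diameter (U n) \<le> \<delta>"
    have "?X \<le> (\<Sum>n. diam_pow s (f ` U n))"
      unfolding hausdorff_delta_def
    proof (rule INF_lower, clarify, intro conjI allI)
      show "f ` E \<subseteq> (\<Union>n. f ` U n)"
        using U(1) by blast
      show "bounded (f ` U n)" "diameter (f ` U n) \<le> c * \<delta>" for n
        using diameter_similarity_image[OF c f, of "U n"] U(2) c by simp_all
    qed
    also have "\<dots> = ennreal (c powr s) * (\<Sum>n. diam_pow s (U n))"
      using U(2) by (simp add: diam_pow_similarity_image[OF c f] ennreal_suminf_cmult)
    finally have "ennreal (1 / c powr s) * ?X
        \<le> ennreal (1 / c powr s) * (ennreal (c powr s) * (\<Sum>n. diam_pow s (U n)))"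
      by (rule mult_left_mono) simp
    then show "ennreal (1 / c powr s) * ?X \<le> (\<Sum>n. diam_pow s (U n))"
      by (simp only: cancel)
  qed
  then have "ennreal (c powr s) * (ennreal (1 / c powr s) * ?X)
      \<le> ennreal (c powr s) * hausdorff_delta s \<delta> E"
    by (rule mult_left_mono) simp
  then show ?thesis
    by (simp only: cancel)
qed

lemma hausdorff_measure_similarity_image_le:
  assumes c: "0 < c" and f: "\<And>x y. dist (f x) (f y) = c * dist x y"
  shows "hausdorff_measure s (f ` E) \<le> ennreal (c powr s) * hausdorff_measure s E"
  unfolding hausdorff_measure_def[of s "f ` E"]
proof (rule SUP_least)
  fix \<delta> :: real
  assume \<delta>: "\<delta> \<in> {0<..}"
  \<comment> \<open>The scale \<open>\<delta> / c\<close> on \<open>E\<close> is the one that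
    becomes \<delta> after scaling by \<open>c\<close>.\<close>
  have "hausdorff_delta s (c * (\<delta> / c)) (f ` E) \<le> ennreal (c powr s) * hausdorff_delta s (\<delta> / c) E"
    by (rule hausdorff_delta_similarity_image_le[OF c f])
  also have "\<dots> \<le> ennreal (c powr s) * hausdorff_measure s E"
    unfolding hausdorff_measure_def using \<delta> c by (intro mult_left_mono SUP_upper) auto
  finally show "hausdorff_delta s \<delta> (f ` E) \<le> ennreal (c powr s) * hausdorff_measure s E"
    using c by simp
qed

text \<open>Both inequalities come from the one-sided estimate, applied to the homothety and to its
  inverse of ratio \<open>1 / c\<close>.\<close>

lemma hausdorff_measure_homothety:
  fixes E :: "'a::real_normed_vector set"
  assumes c: "0 < c"
  shows "hausdorff_measure s ((\<lambda>x. c *\<^sub>R x + b) ` E) = ennreal (c powr s) * hausdorff_measure s E"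
proof (rule antisym)
  let ?f = "\<lambda>x. c *\<^sub>R x + b" and ?g = "\<lambda>y. (1 / c) *\<^sub>R (y - b)"
  show "hausdorff_measure s (?f ` E) \<le> ennreal (c powr s) * hausdorff_measure s E"
    using c by (intro hausdorff_measure_similarity_image_le)
      (auto simp: dist_norm simp flip: scaleR_diff_right)
  have "hausdorff_measure s (?g ` ?f ` E) \<le> ennreal ((1 / c) powr s) * hausdorff_measure s (?f ` E)"
    using c by (intro hausdorff_measure_similarity_image_le)
      (auto simp: dist_norm simp flip: scaleR_diff_right)
  also have "?g ` ?f ` E = E"
    using c by (simp add: image_image)
  finally have "ennreal (c powr s) * hausdorff_measure s E
      \<le> ennreal (c powr s) * (ennreal ((1 / c) powr s) * hausdorff_measure s (?f ` E))"
    by (rule mult_left_mono) simp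
  also have "\<dots> = hausdorff_measure s (?f ` E)"
    using c by (simp add: powr_divide flip: mult.assoc ennreal_mult)
  finally show "ennreal (c powr s) * hausdorff_measure s E \<le> hausdorff_measure s (?f ` E)" .
qed


section \<open>Finite groups, stochastic matrices and the maximum principle\<close>

text \<open>\<open>generate\<close> also admits inverses, whereas an edge only multiplies by a
  generator on the right. Finiteness bridges this gap: division by a generator is realised by a
  forward path.\<close>

lemma (in group) finite_generate_connected:
  assumes A: "A \<subseteq> carrier G" and fin: "finite (generate G A)"
    and x: "x \<in> generate G A" and y: "y \<in> generate G A"
  shows "(x, y) \<in> {(g, g \<otimes> a) |g a. g \<in> generate G A \<and> a \<in> A}\<^sup>*"
proof -
  let ?H = "generate G A"
  let ?R = "{(g, g \<otimes> a) |g a. g \<in> ?H \<and> a \<in> A}"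
  have H: "?H \<subseteq> carrier G"
    by (rule generate_incl[OF A])
  \<comment> \<open>Right multiplication by a generator is an injection of the finite set of elements reachable
    from \<open>g\<close> into itself, hence onto; so this set is also closed under division by generators.\<close>
  have right_div: "(g, g \<otimes> inv a) \<in> ?R\<^sup>*" if g: "g \<in> ?H" and a: "a \<in> A" for g a
  proof -
    let ?C = "?R\<^sup>* `` {g}"
    have C: "?C \<subseteq> ?H"
    proof
      fix z assume "z \<in> ?C"
      then have "(g, z) \<in> ?R\<^sup>*" by simp
      then show "z \<in> ?H"
        by (induction rule: rtrancl_induct) (auto intro: generate.eng generate.incl g)
    qed
    have "(\<lambda>z. z \<otimes> a) ` ?C \<subseteq> ?C"
    proof (rule image_subsetI)
      fix z assume z: "z \<in> ?C"
      then have "(z, z \<otimes> a) \<in> ?R"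
        using a C by blast
      then show "z \<otimes> a \<in> ?C"
        using z by (auto intro: rtrancl_into_rtrancl)
    qed
    moreover have "inj_on (\<lambda>z. z \<otimes> a) ?C"
    proof (rule inj_onI)
      fix z z' assume z: "z \<in> ?C" "z' \<in> ?C" and eq: "z \<otimes> a = z' \<otimes> a"
      have "z \<in> carrier G" "z' \<in> carrier G" "a \<in> carrier G"
        using z C H A a by blast+
      then show "z = z'"
        using eq by simp
    qed
    ultimately have "(\<lambda>z. z \<otimes> a) ` ?C = ?C"
      using finite_subset[OF C fin] by (intro endo_inj_surj)
    moreover have "g \<in> ?C"
      by simp
    ultimately obtain z where z: "z \<in> ?C" "g = z \<otimes> a"
      by (metis (no_types, lifting) imageE)
    moreover have "z \<in> carrier G" "a \<in> carrier G"
      using z C H A a by blast+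
    ultimately have "z = g \<otimes> inv a"
      by (simp add: m_assoc)
    then show ?thesis
      using z by simp
  qed
  \<comment> \<open>The start \<open>g\<close> stays arbitrary in the induction because for a
    product the path for \<open>h2\<close> begins at \<open>g \<otimes> h1\<close>.\<close>
  have mult: "(g, g \<otimes> h) \<in> ?R\<^sup>*" if "h \<in> ?H" "g \<in> ?H" for g h
    using that
  proof (induction h arbitrary: g rule: generate.induct)
    case one
    then show ?case using H by auto
  next
    case (incl h)
    then show ?case by blast
  next
    case (inv h)
    then show ?case by (intro right_div)
  next
    case (eng h1 h2)
    have "(g, g \<otimes> h1) \<in> ?R\<^sup>*" "(g \<otimes> h1, g \<otimes> h1 \<otimes> h2) \<in> ?R\<^sup>*"
      using eng by (auto intro: generate.eng)
    moreover have "g \<otimes> h1 \<otimes> h2 = g \<otimes> (h1 \<otimes> h2)"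
      using eng H by (intro m_assoc) auto
    ultimately show ?case
      by (metis (no_types, lifting) rtrancl_trans)
  qed
  have "(x, x \<otimes> (inv x \<otimes> y)) \<in> ?R\<^sup>*"
    using x y by (intro mult generate.eng generate_m_inv_closed[OF A])
  moreover have "x \<in> carrier G" "y \<in> carrier G"
    using x y H by blast+
  then have "x \<otimes> (inv x \<otimes> y) = y"
    by (simp flip: m_assoc)
  ultimately show ?thesis
    by simp
qed

text \<open>Reading an eigenvector equation at a coordinate of largest modulus bounds every
  eigenvalue by the row sum 1; the constant vector is an eigenvector for the eigenvalue 1.\<close>

lemma spectral_radius_stochastic:
  fixes a :: "nat \<Rightarrow> nat \<Rightarrow> real"
  assumes n: "0 < n" and nonneg: "\<And>i j. i < n \<Longrightarrow> j < n \<Longrightarrow> 0 \<le> a i j"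
    and row: "\<And>i. i < n \<Longrightarrow> (\<Sum>j<n. a i j) = 1"
  shows "spectral_radius (mat n n (\<lambda>(i, j). complex_of_real (a i j))) = 1"
proof (rule antisym)
  let ?A = "mat n n (\<lambda>(i, j). complex_of_real (a i j))"
  have A: "?A \<in> carrier_mat n n" by simp
  have mult: "vec_index (?A *\<^sub>v w) i = (\<Sum>j<n. complex_of_real (a i j) * vec_index w j)"
    if "w \<in> carrier_vec n" "i < n" for w i
    using that by (simp add: scalar_prod_def atLeast0LessThan)
  show "spectral_radius ?A \<le> 1"
  proof -
    obtain l where l: "l \<in> spectrum ?A" "spectral_radius ?A = norm l"
      using spectral_radius_mem_max(1)[OF A n] by auto
    then obtain w where w: "w \<in> carrier_vec n" "w \<noteq> 0\<^sub>v n" "?A *\<^sub>v w = l \<cdot>\<^sub>v w"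
      by (auto simp: spectrum_def eigenvalue_def eigenvector_def)
    let ?N = "(\<lambda>j. norm (vec_index w j)) ` {..<n}"
    have "Max ?N \<in> ?N"
      using n by (intro Max_in) auto
    then obtain i where i: "i < n" "Max ?N = norm (vec_index w i)"
      by auto
    have max: "norm (vec_index w j) \<le> norm (vec_index w i)" if "j < n" for j
      using that i(2) by (metis Max_ge finite_imageI finite_lessThan imageI lessThan_iff)
    \<comment> \<open>Strict positivity allows this modulus to be cancelled from the final
      estimate.\<close>
    have pos: "norm (vec_index w i) > 0"
    proof (rule ccontr)
      assume "\<not> ?thesis"
      then have "vec_index w j = 0" if "j < n" for j
        using max[OF that] by simp
      then have "w = 0\<^sub>v n"
        using w(1) by (intro eq_vecI) auto
      with w(2) show False by simp
    qed
    have "norm l * norm (vec_index w i) = norm (vec_index (?A *\<^sub>v w) i)"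
      using w i(1) by (simp add: norm_mult)
    also have "\<dots> \<le> (\<Sum>j<n. norm (complex_of_real (a i j) * vec_index w j))"
      unfolding mult[OF w(1) i(1)] by (rule norm_sum)
    also have "\<dots> \<le> (\<Sum>j<n. a i j * norm (vec_index w i))"
      using max nonneg[OF i(1)] by (intro sum_mono) (auto simp: norm_mult intro!: mult_left_mono)
    also have "\<dots> = norm (vec_index w i)"
      using row[OF i(1)] by (simp flip: sum_distrib_right)
    finally show ?thesis
      using pos l(2) by simp
  qed
  show "1 \<le> spectral_radius ?A"
  proof (rule spectral_radius_mem_max(2)[OF A n])
    let ?w = "Matrix.vec n (\<lambda>_. 1 :: complex)"
    have "?A *\<^sub>v ?w = 1 \<cdot>\<^sub>v ?w"
    proof (rule eq_vecI)
      fix i assume "i < dim_vec (1 \<cdot>\<^sub>v ?w)"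
      then have i: "i < n" by simp
      then have "vec_index (?A *\<^sub>v ?w) i = complex_of_real (\<Sum>j<n. a i j)"
        using mult[of ?w i] by simp
      then show "vec_index (?A *\<^sub>v ?w) i = vec_index (1 \<cdot>\<^sub>v ?w) i"
        using row i by simp
    qed simp
    moreover have "?w \<noteq> 0\<^sub>v n"
      using n by (auto simp: vec_eq_iff)
    ultimately have "eigenvalue ?A 1"
      unfolding eigenvalue_def eigenvector_def by (intro exI[of _ ?w]) auto
    then have "1 \<in> spectrum ?A"
      by (simp add: spectrum_def)
    then show "1 \<in> norm ` spectrum ?A"
      by (force simp: image_iff)
  qed
qed

text \<open>Grouping the edges out of \<open>i\<close> by their heads turns the sum over these edges
  into a row sum of the matrix, which is then row-stochastic.\<close>

lemma gd_similarity_dimensionI: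
  assumes fin: "fin_digraph G" and V: "verts G = {1..q}" and q: "0 < q"
    and out: "\<And>i. i \<in> verts G \<Longrightarrow> (\<Sum>e | e \<in> arcs G \<and> tail G e = i. r e powr s) = 1"
  shows "gd_similarity_dimension q G r s"
  unfolding gd_similarity_dimension_def gd_matrix_def
proof (rule spectral_radius_stochastic[OF q])
  interpret fin_digraph G by (rule fin)
  fix i assume i: "i < q"
  let ?O = "{e \<in> arcs G. tail G e = Suc i}"
  \<comment> \<open>Columns are numbered from 0 and vertices from 1;
    \<open>sum.atLeast1_atMost_eq\<close> undoes the shift.\<close>
  have "(\<Sum>j<q. \<Sum>e\<in>edges_between G (Suc i) (Suc j). r e powr s)
      = (\<Sum>j\<in>{1..q}. \<Sum>e | e \<in> ?O \<and> head G e = j. r e powr s)"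
    by (simp add: sum.atLeast1_atMost_eq edges_between_def conj_assoc)
  also have "\<dots> = (\<Sum>e\<in>?O. r e powr s)"
    using V head_in_verts by (intro sum.group) auto
  also have "\<dots> = 1"
    using out[of "Suc i"] i V by simp
  finally show "(\<Sum>j<q. \<Sum>e\<in>edges_between G (Suc i) (Suc j). r e powr s) = 1" .
qed (auto intro: sum_nonneg)

text \<open>Maximum principle: a value bounded by a weighted average of its successors can be
  maximal only if all of them are maximal too, and connectedness spreads the maximum over
  \<open>V\<close>.\<close>

lemma subharmonic_constant:
  fixes h :: "'a \<Rightarrow> ennreal" and w :: "'k \<Rightarrow> real" and t :: "'a \<Rightarrow> 'k \<Rightarrow> 'a"
  assumes V: "finite V" and I: "finite I"
    and t: "\<And>x k. x \<in> V \<Longrightarrow> k \<in> I \<Longrightarrow> t x k \<in> V"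
    and w: "\<And>k. k \<in> I \<Longrightarrow> 0 < w k" "(\<Sum>k\<in>I. w k) = 1"
    and sub: "\<And>x. x \<in> V \<Longrightarrow> h x \<le> (\<Sum>k\<in>I. ennreal (w k) * h (t x k))"
    and super: "\<And>x k. x \<in> V \<Longrightarrow> k \<in> I \<Longrightarrow> ennreal (w k) * h (t x k) \<le> h x"
    and conn: "\<And>x y. x \<in> V \<Longrightarrow> y \<in> V \<Longrightarrow> (x, y) \<in> {(x, t x k) |x k. x \<in> V \<and> k \<in> I}\<^sup>*"
    and x: "x \<in> V" and y: "y \<in> V"
  shows "h x = h y"
proof (cases "\<exists>z\<in>V. h z = Orderings.top")
  \<comment> \<open>Infinite values propagate backwards along edges by \<open>super\<close>.\<close>
  case True
  then obtain z where z: "z \<in> V" "h z = Orderings.top" by blast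
  have "h u = Orderings.top" if "u \<in> V" for u
    using conn[OF that z(1)]
  proof (induction rule: converse_rtrancl_induct)
    case base
    then show ?case using z by simp
  next
    case (step u v)
    then obtain k where k: "u \<in> V" "k \<in> I" "v = t u k" by blast
    then have "ennreal (w k) * h v = Orderings.top"
      using step.IH w(1)[of k] by (simp add: ennreal_mult_eq_top_iff)
    then show ?case
      using super[of u k] k by (simp add: top_unique)
  qed
  then show ?thesis using x y by simp
next
  case False
  \<comment> \<open>With all values finite, passing to reals makes subtraction available.\<close>
  define g where "g z = enn2real (h z)" for z
  have h: "h z = ennreal (g z)" if "z \<in> V" for z
    using False that by (auto simp: g_def less_top)
  have g0: "0 \<le> g z" for z
    by (simp add: g_def)
  have gsub: "g z \<le> (\<Sum>k\<in>I. w k * g (t z k))" if z: "z \<in> V" for z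
  proof -
    have "ennreal (g z) \<le> (\<Sum>k\<in>I. ennreal (w k) * ennreal (g (t z k)))"
      using sub[OF z] h t z by simp
    also have "\<dots> = ennreal (\<Sum>k\<in>I. w k * g (t z k))"
      using w(1) g0 by (simp add: less_imp_le flip: ennreal_mult)
    finally show ?thesis
      using w(1) g0 by (subst (asm) ennreal_le_iff) (simp_all add: less_imp_le sum_nonneg)
  qed
  have "Max (g ` V) \<in> g ` V"
    using V x by (intro Max_in) auto
  then obtain z where z: "z \<in> V" "g z = Max (g ` V)"
    by auto
  have max: "g u \<le> g z" if "u \<in> V" for u
    using that V z(2) by simp
  have "g u = g z" if "u \<in> V" for u
    using conn[OF z(1) that]
  proof (induction rule: rtrancl_induct)
    case (step u v)
    then obtain k where k: "u \<in> V" "k \<in> I" "v = t u k" by blast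
    \<comment> \<open>\<open>g u\<close> equals the maximum \<open>g z\<close>, so the weighted
      deficits of the successors of \<open>u\<close> have sum at most 0. Being nonnegative, they all
      vanish.\<close>
    have "(\<Sum>k\<in>I. w k * (g z - g (t u k))) = g z * (\<Sum>k\<in>I. w k) - (\<Sum>k\<in>I. w k * g (t u k))"
      by (simp add: right_diff_distrib sum_subtractf sum_distrib_left mult.commute)
    also have "\<dots> \<le> 0"
      using gsub[OF k(1)] step.IH w(2) by simp
    finally have "(\<Sum>k\<in>I. w k * (g z - g (t u k))) \<le> 0" .
    moreover have nonneg: "0 \<le> w k * (g z - g (t u k))" if "k \<in> I" for k
      using w(1)[OF that] max[OF t[OF k(1) that]] by simp
    ultimately have "(\<Sum>k\<in>I. w k * (g z - g (t u k))) = 0"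
      by (intro antisym sum_nonneg) auto
    then have "w k * (g z - g (t u k)) = 0"
      using sum_nonneg_eq_0_iff[OF I, of "\<lambda>k. w k * (g z - g (t u k))"] nonneg k(2) by blast
    then show ?case
      using w(1)[OF k(2)] k(3) by simp
  qed simp
  then show ?thesis
    using h x y by simp
qed


section \<open>The transformation group\<close>

text \<open>The product of \<open>BijGroup\<close> is composition restricted to the base set; over
  \<open>UNIV\<close> the restriction disappears.\<close>

lemma mult_BijGroup_UNIV:
  "f \<in> carrier (BijGroup UNIV) \<Longrightarrow> g \<in> carrier (BijGroup UNIV) \<Longrightarrow> f \<otimes>\<^bsub>BijGroup UNIV\<^esub> g = f \<circ> g"
  by (auto simp: BijGroup_def compose_def)

lemma orthogonal_transformation_in_BijGroup:
  fixes f :: "'a::euclidean_space \<Rightarrow> 'a"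
  shows "orthogonal_transformation f \<Longrightarrow> f \<in> carrier (BijGroup UNIV)"
  by (simp add: BijGroup_def Bij_def orthogonal_transformation_bij)

text \<open>Orthogonal maps are closed under composition and inversion. This supplies the linearity
  of group elements and their membership in the carrier.\<close>

lemma transformation_group_orthogonal:
  fixes T :: "nat \<Rightarrow> 'a::euclidean_space \<Rightarrow> 'a"
  assumes T: "\<forall>k\<in>{1..m}. orthogonal_transformation (T k)"
    and g: "g \<in> transformation_group m T"
  shows "orthogonal_transformation g"
  using g unfolding transformation_group_def
proof (induction rule: generate.induct)
  case one
  have "\<one>\<^bsub>BijGroup UNIV\<^esub> = (\<lambda>x::'a. x)" by (auto simp: BijGroup_def)
  then show ?case
    by (simp add: orthogonal_transformation_def linear_id[unfolded id_def])
next
  case (incl h)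
  then show ?case using T by auto
next
  case (inv h)
  then have h: "orthogonal_transformation h" using T by auto
  then have "inv\<^bsub>BijGroup UNIV\<^esub> h = Hilbert_Choice.inv h"
    using orthogonal_transformation_in_BijGroup[OF h]
    by (subst inv_BijGroup) (auto simp: BijGroup_def)
  then show ?case
    using h by (simp add: orthogonal_transformation_inv)
next
  case (eng f g)
  then show ?case
    by (simp add: mult_BijGroup_UNIV orthogonal_transformation_in_BijGroup
        orthogonal_transformation_compose del: o_apply)
qed

lemma transformation_group_comp:
  fixes T :: "nat \<Rightarrow> 'a::euclidean_space \<Rightarrow> 'a" and m :: nat
  assumes T: "\<forall>k\<in>{1..m}. orthogonal_transformation (T k)"
    and g: "g \<in> transformation_group m T" and k: "k \<in> {1..m}"
  shows "g \<circ> T k \<in> transformation_group m T"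
proof -
  have "g \<otimes>\<^bsub>BijGroup UNIV\<^esub> T k \<in> transformation_group m T"
    using g generate.incl[OF imageI[OF k], of T "BijGroup UNIV"]
    unfolding transformation_group_def by (intro generate.eng)
  then show ?thesis
    using transformation_group_orthogonal[OF T g] T k
    by (simp add: mult_BijGroup_UNIV orthogonal_transformation_in_BijGroup)
qed

text \<open>Connectedness of the Cayley graph, with the abstract group product rewritten as
  composition of maps.\<close>

lemma transformation_group_connected:
  fixes T :: "nat \<Rightarrow> 'a::euclidean_space \<Rightarrow> 'a" and m :: nat
  defines "H \<equiv> transformation_group m T"
  assumes T: "\<forall>k\<in>{1..m}. orthogonal_transformation (T k)"
    and fin: "finite H" and x: "x \<in> H" and y: "y \<in> H"
  shows "(x, y) \<in> {(g, g \<circ> T k) |g k. g \<in> H \<and> k \<in> {1..m}}\<^sup>*"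
proof -
  let ?B = "BijGroup (UNIV :: 'a set)"
  have T': "T ` {1..m} \<subseteq> carrier ?B"
    using T orthogonal_transformation_in_BijGroup by blast
  have "(x, y) \<in> {(g, g \<otimes>\<^bsub>?B\<^esub> a) |g a. g \<in> H \<and> a \<in> T ` {1..m}}\<^sup>*"
    using group.finite_generate_connected[OF group_BijGroup T'] fin x y
    unfolding H_def transformation_group_def by blast
  also have "{(g, g \<otimes>\<^bsub>?B\<^esub> a) |g a. g \<in> H \<and> a \<in> T ` {1..m}}
      = {(g, g \<circ> T k) |g k. g \<in> H \<and> k \<in> {1..m}}"
  proof -
    have "g \<otimes>\<^bsub>?B\<^esub> T k = g \<circ> T k" if "g \<in> H" "k \<in> {1..m}" for g k
      using that transformation_group_orthogonal[OF T, of g] T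
      by (simp add: H_def mult_BijGroup_UNIV orthogonal_transformation_in_BijGroup)
    then show ?thesis by (force simp: image_iff)
  qed
  finally show ?thesis .
qed

text \<open>By linearity \<open>L (g (S k x)) = r k *\<^sub>R L (g (T k x)) + L (g (v k))\<close>.
  The orthogonal part is absorbed into the index \<open>g \<circ> T k\<close>, leaving a
  homothety.\<close>

lemma image_attractor_decomposition:
  fixes L :: "'a::euclidean_space \<Rightarrow> 'b::euclidean_space"
  assumes ifs: "ss_ifs m S r T v" and att: "ss_attractor m S K"
    and L: "linear L" and g: "linear g"
  shows "(L \<circ> g) ` K
    = (\<Union>k\<in>{1..m}. (\<lambda>x. r k *\<^sub>R x + L (g (v k))) ` (L \<circ> (g \<circ> T k)) ` K)"
proof -
  have S: "S k x = r k *\<^sub>R T k x + v k" if "k \<in> {1..m}" for k x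
    using ifs that by (auto simp: ss_ifs_def contracting_similarity_def)
  have "(L \<circ> g) ` K = (\<Union>k\<in>{1..m}. (L \<circ> g) ` S k ` K)"
    using att unfolding ss_attractor_def by (metis image_UN)
  also have "\<dots> = (\<Union>k\<in>{1..m}. (\<lambda>x. r k *\<^sub>R x + L (g (v k))) ` (L \<circ> (g \<circ> T k)) ` K)"
    using L g S by (intro SUP_cong refl)
      (simp add: image_image linear_add linear_scale cong: image_cong)
  finally show ?thesis .
qed

section \<open>The projected graph directed system and its Hausdorff measures\<close>

theorem theorem1p1:
  fixes m q :: nat
    and S :: "nat \<Rightarrow> real ^ 'd \<Rightarrow> real ^ 'd"
    and r :: "nat \<Rightarrow> real"
    and T :: "nat \<Rightarrow> real ^ 'd \<Rightarrow> real ^ 'd"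
    and v :: "nat \<Rightarrow> real ^ 'd"
    and K :: "(real ^ 'd) set"
    and s :: real
    and L :: "real ^ 'd \<Rightarrow> real ^ 'd2"
    and Orth :: "nat \<Rightarrow> real ^ 'd \<Rightarrow> real ^ 'd"
  assumes "ss_ifs m S r T v"
    and "ss_attractor m S K"
    and "\<exists>x\<in>K. \<exists>y\<in>K. x \<noteq> y"
    and "ss_similarity_dimension m r s"
    and "linear L"
    and "finite (transformation_group m T)"
    and "q = card (transformation_group m T)"
    and "bij_betw Orth {1..q} (transformation_group m T)"
  shows "(\<exists>(G :: (nat, nat) pre_digraph) (S' :: nat \<Rightarrow> real ^ 'd2 \<Rightarrow> real ^ 'd2) r' T' v'.
            gd_ifs q G S' r' T' v' \<and>
            strongly_connected G \<and>
            gd_attractor q G S' (\<lambda>i. (L \<circ> Orth i) ` K) \<and>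
            gd_similarity_dimension q G r' s \<and>
            (\<forall>e\<in>arcs G. T' e = id))
       \<and> (\<forall>i\<in>{1..q}. \<forall>j\<in>{1..q}.
            hausdorff_measure s ((L \<circ> Orth i) ` K) = hausdorff_measure s ((L \<circ> Orth j) ` K))"
proof
  let ?H = "transformation_group m T"
  have T: "\<forall>k\<in>{1..m}. orthogonal_transformation (T k)"
    using assms(1) by (auto simp: ss_ifs_def contracting_similarity_def)
  have r: "0 < r k" "r k < 1" if "k \<in> {1..m}" for k
    using assms(1) that by (auto simp: ss_ifs_def contracting_similarity_def)
  have m: "1 \<le> m"
    using assms(1) by (simp add: ss_ifs_def)
  have K: "compact K" "K \<noteq> {}"
    using assms(2) by (auto simp: ss_attractor_def)
  have lin: "linear g" if "g \<in> ?H" for g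
    using transformation_group_orthogonal[OF T that] by (rule orthogonal_transformation_linear)
  note comp = transformation_group_comp[OF T]
  note conn = transformation_group_connected[OF T assms(6)]
  note decomp = image_attractor_decomposition[OF assms(1,2,5) lin]
  have Orth: "Orth i \<in> ?H" if "i \<in> {1..q}" for i
    using assms(8) that by (auto simp: bij_betw_def)
  \<comment> \<open>Inverse of the given enumeration, converting group elements to vertex
    numbers.\<close>
  define idx where "idx = inv_into {1..q} Orth"
  have idx: "idx g \<in> {1..q}" "Orth (idx g) = g" if "g \<in> ?H" for g
    using assms(8) that unfolding idx_def bij_betw_def
    by (auto intro: inv_into_into f_inv_into_f simp del: atLeastAtMost_iff)
  have idx_Orth: "idx (Orth i) = i" if "i \<in> {1..q}" for i
    using assms(8) that unfolding idx_def bij_betw_def by (intro inv_into_f_f) auto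
  \<comment> \<open>The group contains the identity, so the graph has a vertex.\<close>
  have q: "0 < q"
    using assms(6,7) generate.one[of "BijGroup UNIV" "T ` {1..m}"]
    by (auto simp: card_gt_0_iff transformation_group_def)

  \<comment> \<open>An edge is the code of a pair (source, label). Distinct labels give distinct
    edges even if some \<open>T k\<close> coincide, so parallel edges are kept.\<close>
  let ?src = "\<lambda>e. fst (prod_decode e)" and ?lab = "\<lambda>e. snd (prod_decode e)"
  let ?j = "\<lambda>i k. idx (Orth i \<circ> T k)"
  define G :: "(nat, nat) pre_digraph" where
    "G = \<lparr>verts = {1..q}, arcs = prod_encode ` ({1..q} \<times> {1..m}),
          tail = ?src, head = (\<lambda>e. ?j (?src e) (?lab e))\<rparr>"
  define r' where "r' e = r (?lab e)" for e
  define v' where "v' e = L (Orth (?src e) (v (?lab e)))" for e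
  define S' where "S' e x = r' e *\<^sub>R x + v' e" for e x
  have j: "?j i k \<in> {1..q}" "Orth (?j i k) = Orth i \<circ> T k" if "i \<in> {1..q}" "k \<in> {1..m}" for i k
    using idx comp Orth that by blast+
  have fin: "fin_digraph G"
    by unfold_locales (use j in \<open>auto simp: G_def\<close>)
  interpret fin_digraph G by (rule fin)
  have out: "{e \<in> arcs G. tail G e = i} = (\<lambda>k. prod_encode (i, k)) ` {1..m}" if "i \<in> {1..q}" for i
    using that by (auto simp: G_def)
  have "gd_ifs q G S' r' (\<lambda>_. id) v'"
    unfolding gd_ifs_def
  proof (intro conjI ballI)
    fix i assume "i \<in> verts G"
    then show "\<exists>e\<in>arcs G. tail G e = i"
      using m by (intro bexI[of _ "prod_encode (i, 1)"]) (auto simp: G_def)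
  next
    fix e assume "e \<in> arcs G"
    then have "?lab e \<in> {1..m}" by (auto simp: G_def)
    then show "contracting_similarity (S' e) (r' e) id (v' e)"
      using r by (auto simp: contracting_similarity_def S'_def r'_def
          orthogonal_transformation_def linear_id)
  qed (rule fin, simp add: G_def)
  moreover have "strongly_connected G"
    unfolding strongly_connected_def
  proof (intro conjI ballI)
    show "verts G \<noteq> {}" using q by (simp add: G_def)
    fix i j' assume i: "i \<in> verts G" and j': "j' \<in> verts G"
    then have ij: "i \<in> {1..q}" "j' \<in> {1..q}" by (auto simp: G_def)
    \<comment> \<open>A path in the Cayley graph on group elements is transported through
      \<open>idx\<close>; the step from \<open>g\<close> to \<open>g \<circ> T k\<close> is the edge
      coded by \<open>(idx g, k)\<close>.\<close>
    have "i \<rightarrow>\<^sup>*\<^bsub>G\<^esub> idx (Orth j')"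
      using conn[OF Orth[OF ij(1)] Orth[OF ij(2)]]
    proof (induction rule: rtrancl_induct)
      case base
      then show ?case using i ij idx_Orth by simp
    next
      case (step g h)
      then obtain k where k: "g \<in> ?H" "k \<in> {1..m}" "h = g \<circ> T k" by blast
      have "idx g \<rightarrow>\<^bsub>G\<^esub> idx h"
        using k idx[OF k(1)] by (intro dominatesI[where a = "prod_encode (idx g, k)"])
          (auto simp: arc_to_ends_def G_def)
      with step.IH show ?case by (rule reachable_adj_trans)
    qed
    then show "i \<rightarrow>\<^sup>*\<^bsub>G\<^esub> j'"
      using ij idx_Orth by simp
  qed
  moreover have "gd_attractor q G S' (\<lambda>i. (L \<circ> Orth i) ` K)"
    unfolding gd_attractor_def
  proof (intro ballI conjI)
    fix i assume i: "i \<in> {1..q}"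
    have "linear (L \<circ> Orth i)"
      using lin[OF Orth[OF i]] assms(5) by (rule linear_compose)
    then show "compact ((L \<circ> Orth i) ` K)"
      using K by (intro compact_continuous_image linear_continuous_on linear_conv_bounded_linear[THEN iffD1])
    show "(L \<circ> Orth i) ` K \<noteq> {}"
      using K by simp
    \<comment> \<open>Each edge has exactly one head, so the double union collapses to a union over
      the outgoing edges, that is, over the labels \<open>k\<close>.\<close>
    have "(\<Union>j\<in>{1..q}. \<Union>e\<in>edges_between G i j. S' e ` (L \<circ> Orth j) ` K)
        = (\<Union>e\<in>{e \<in> arcs G. tail G e = i}. S' e ` (L \<circ> Orth (head G e)) ` K)"
      using head_in_verts by (fastforce simp: edges_between_def G_def)
    also have "\<dots> = (\<Union>k\<in>{1..m}. S' (prod_encode (i, k)) ` (L \<circ> Orth (?j i k)) ` K)"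
      unfolding out[OF i] by (simp add: G_def)
    also have "\<dots> = (\<Union>k\<in>{1..m}. (\<lambda>x. r k *\<^sub>R x + L (Orth i (v k))) ` (L \<circ> (Orth i \<circ> T k)) ` K)"
      using j(2)[OF i] by (intro SUP_cong refl) (simp add: S'_def r'_def v'_def)
    also have "\<dots> = (L \<circ> Orth i) ` K"
      using decomp[OF Orth[OF i]] by simp
    finally show "(L \<circ> Orth i) ` K
        = (\<Union>j\<in>{1..q}. \<Union>e\<in>edges_between G i j. S' e ` (L \<circ> Orth j) ` K)" ..
  qed
  moreover have "gd_similarity_dimension q G r' s"
  proof (rule gd_similarity_dimensionI[OF fin _ q])
    show "verts G = {1..q}" by (simp add: G_def)
    fix i assume "i \<in> verts G"
    then have i: "i \<in> {1..q}" by (simp add: G_def)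
    have "(\<Sum>e | e \<in> arcs G \<and> tail G e = i. r' e powr s) = (\<Sum>k\<in>{1..m}. r k powr s)"
      unfolding out[OF i] by (subst sum.reindex) (auto simp: inj_on_def r'_def)
    then show "(\<Sum>e | e \<in> arcs G \<and> tail G e = i. r' e powr s) = 1"
      using assms(4) by (simp add: ss_similarity_dimension_def)
  qed
  ultimately show "\<exists>(G :: (nat, nat) pre_digraph) (S' :: nat \<Rightarrow> real ^ 'd2 \<Rightarrow> real ^ 'd2) r' T' v'.
      gd_ifs q G S' r' T' v' \<and> strongly_connected G \<and>
      gd_attractor q G S' (\<lambda>i. (L \<circ> Orth i) ` K) \<and>
      gd_similarity_dimension q G r' s \<and> (\<forall>e\<in>arcs G. T' e = id)"
    by blast

  \<comment> \<open>Equality of the Hausdorff measures\<close>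
  have hom: "hausdorff_measure s ((\<lambda>x. r k *\<^sub>R x + b) ` (L \<circ> (g \<circ> T k)) ` K)
      = ennreal (r k powr s) * hausdorff_measure s ((L \<circ> (g \<circ> T k)) ` K)"
    if "k \<in> {1..m}" for g k and b :: "real ^ 'd2"
    by (rule hausdorff_measure_homothety[OF r(1)[OF that]])
  have "hausdorff_measure s ((L \<circ> g) ` K) = hausdorff_measure s ((L \<circ> h) ` K)"
    if "g \<in> ?H" "h \<in> ?H" for g h
  \<comment> \<open>The weights \<open>r k powr s\<close> sum to 1 by the choice of
    \<open>s\<close>.\<close>
  proof (rule subharmonic_constant[where V = ?H and I = "{1..m}" and t = "\<lambda>g k. g \<circ> T k"
        and w = "\<lambda>k. r k powr s" and h = "\<lambda>g. hausdorff_measure s ((L \<circ> g) ` K)"])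
    fix g assume g: "g \<in> ?H"
    have "hausdorff_measure s ((L \<circ> g) ` K)
        \<le> (\<Sum>k\<in>{1..m}. hausdorff_measure s
              ((\<lambda>x. r k *\<^sub>R x + L (g (v k))) ` (L \<circ> (g \<circ> T k)) ` K))"
      unfolding decomp[OF g] by (rule hausdorff_measure_UN_le) simp
    then show "hausdorff_measure s ((L \<circ> g) ` K)
        \<le> (\<Sum>k\<in>{1..m}. ennreal (r k powr s) * hausdorff_measure s ((L \<circ> (g \<circ> T k)) ` K))"
      by (simp only: hom cong: sum.cong)
    fix k assume k: "k \<in> {1..m}"
    show "ennreal (r k powr s) * hausdorff_measure s ((L \<circ> (g \<circ> T k)) ` K)
        \<le> hausdorff_measure s ((L \<circ> g) ` K)"
      \<comment> \<open>The scaled term is the measure of a single piece of the decomposition, and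
        monotonicity bounds it by the whole.\<close>
      unfolding hom[OF k, where b = "L (g (v k))", symmetric]
      by (subst decomp[OF g]) (use k in \<open>blast intro: hausdorff_measure_mono\<close>)
  qed (use assms(4,6) comp conn r(1)[THEN less_imp_neq] that in \<open>auto simp: ss_similarity_dimension_def\<close>)
  then show "\<forall>i\<in>{1..q}. \<forall>j\<in>{1..q}.
      hausdorff_measure s ((L \<circ> Orth i) ` K) = hausdorff_measure s ((L \<circ> Orth j) ` K)"
    using Orth by blast
qed

end
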